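(* Let $\mathfrak{L}$ be a logic and $T$ a theory which is consistent in $\mathfrak{L}$ and Rosser in $\mathfrak{L}$. Then $T$ is essentially undecidable in $\mathfrak{L}$.
   Context: Abstract setting: a countable set of formulas $Fm$ (with a fixed effective coding) containing a distinguished subset of "$\Sigma_1$-formulas", and for each $\Sigma_1$-formula $\varphi$ a distinguished formula $\neg\varphi$. A logic $\mathfrak{L}$ is a relation $\vdash_\mathfrak{L}\subseteq\wp(Fm)\times Fm$ satisfying reflexivity ($\Gamma\cup\{\varphi\}\vdash_\mathfrak{L}\varphi$) and cut (if $\Gamma\vdash_\mathfrak{L}\varphi$ and $\Delta\vdash_\mathfrak{L}\gamma$ for all $\gamma\in\Gamma$, then $\Delta\vdash_\mathfrak{L}\varphi$). A theory is a set of formulas; $C_\mathfrak{L}(T)=\{\varphi\mid T\vdash_\mathfrak{L}\varphi\}$. $T$ is decidable in $\mathfrak{L}$ iff $C_\mathfrak{L}(T)$ is recursive; $S$ strengthens $T$ iff $T\subseteq C_\mathfrak{L}(S)$; $T$ is consistent in $\mathfrak{L}$ iff no $\Sigma_1$-formula $\varphi$ has $T\vdash_\mathfrak{L}\varphi$ and $T\vdash_\mathfrak{L}\neg\varphi$; $T$ is essentially undecidable in $\mathfrak{L}$ iff it is consistent and each consistent theory strengthening it is undecidable. $T$ is Rosser in $\mathfrak{L}$ if for every pair of disjoint recursively enumerable sets $A,B\subseteq\mathbb{N}$ there is a recursive sequence of $\Sigma_1$-formulas $(\varphi_n)_n$ such that $n\in A$ implies $T\vdash_\mathfrak{L}\varphi_n$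 and $n\in B$ implies $T\vdash_\mathfrak{L}\neg\varphi_n$. *)

theory Defs
  imports Main
begin

section \<open>Recursive functions and sets\<close>

text \<open>
  Kleene's \<open>\<mu>\<close>-recursive schemes. Programs carry no arity: on argument lists of a fixed
  length \<open>k\<close>, the relation \<open>computes p\<close> is the graph of a \<open>k\<close>-ary partial recursive function
  (nowhere defined where the arities inside \<open>p\<close> do not match), and every \<open>k\<close>-ary partial
  recursive function arises in this way.
\<close>

datatype recf =
    Zero
  | Succ
  | Proj nat
  | Comp recf "recf list"
  | PrimRec recf recf
  | Mu recf

inductive computes :: "recf \<Rightarrow> nat list \<Rightarrow> nat \<Rightarrow> bool" where
  zero: "computes Zero xs 0"
| succ: "computes Succ [x] (Suc x)"
| proj: "i < length xs \<Longrightarrow> computes (Proj i) xs (xs ! i)"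
| comp: "list_all2 (\<lambda>g y. computes g xs y) gs ys \<Longrightarrow> computes f ys z
    \<Longrightarrow> computes (Comp f gs) xs z"
| primrec_0: "computes g xs y \<Longrightarrow> computes (PrimRec g h) (0 # xs) y"
| primrec_Suc: "computes (PrimRec g h) (n # xs) y \<Longrightarrow> computes h (n # y # xs) z
    \<Longrightarrow> computes (PrimRec g h) (Suc n # xs) z"
| mu: "computes f (n # xs) 0 \<Longrightarrow> (\<forall>i<n. \<exists>y. computes f (i # xs) (Suc y))
    \<Longrightarrow> computes (Mu f) xs n"

inductive_cases computes_ZeroE: "computes Zero xs y"
inductive_cases computes_SuccE: "computes Succ xs y"
inductive_cases computes_ProjE: "computes (Proj i) xs y"
inductive_cases computes_CompE: "computes (Comp f gs) xs y"
inductive_cases computes_PrimRec0E: "computes (PrimRec g h) (0 # xs) y"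
inductive_cases computes_PrimRecSucE: "computes (PrimRec g h) (Suc n # xs) y"
inductive_cases computes_MuE: "computes (Mu f) xs y"

lemma computes_deterministic:
  "computes p xs y \<Longrightarrow> computes p xs y' \<Longrightarrow> y = y'"
proof (induction arbitrary: y' rule: computes.induct)
  case (zero xs)
  then show ?case by (auto elim: computes_ZeroE)
next
  case (succ x)
  then show ?case by (auto elim: computes_SuccE)
next
  case (proj i xs)
  then show ?case by (auto elim: computes_ProjE)
next
  case (comp xs gs ys f z)
  from comp.prems obtain ys' where
    ys': "list_all2 (\<lambda>g y. computes g xs y) gs ys'" "computes f ys' y'"
    by (rule computes_CompE)
  have len: "length gs = length ys" "length gs = length ys'"
    using comp.IH(1) ys'(1) by (auto dest: list_all2_lengthD)
  have "ys ! i = ys' ! i" if "i < length ys" for i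
  proof -
    have "computes (gs ! i) xs (ys' ! i)"
      using list_all2_nthD2[OF ys'(1)] that len by simp
    with list_all2_nthD2[OF comp.IH(1) that] show ?thesis by blast
  qed
  with len have "ys = ys'" by (simp add: nth_equalityI)
  with comp.IH(2) ys'(2) show ?case by simp
next
  case (primrec_0 g xs y h)
  from primrec_0.prems have "computes g xs y'" by (rule computes_PrimRec0E)
  then show ?case by (rule primrec_0.IH)
next
  case (primrec_Suc g h n xs y z)
  from primrec_Suc.prems obtain u where
    "computes (PrimRec g h) (n # xs) u" "computes h (n # u # xs) y'"
    by (rule computes_PrimRecSucE)
  with primrec_Suc.IH show ?case by blast
next
  case (mu f n xs)
  from mu.prems have y': "computes f (y' # xs) 0"
    "\<forall>i<y'. \<exists>y. computes f (i # xs) (Suc y)"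
    by (blast elim: computes_MuE)+
  have "\<not> n < y'" using mu.IH(1) y'(2) by blast
  moreover have "\<not> y' < n" using mu.IH(2) y'(1) by blast
  ultimately show ?case by simp
qed

definition recursive_fun :: "(nat \<Rightarrow> nat) \<Rightarrow> bool" where
  "recursive_fun f \<longleftrightarrow> (\<exists>p. \<forall>n. computes p [n] (f n))"

definition recursive_set :: "nat set \<Rightarrow> bool" where
  "recursive_set A \<longleftrightarrow> recursive_fun (\<lambda>n. if n \<in> A then 1 else 0)"

definition re_set :: "nat set \<Rightarrow> bool" where
  "re_set A \<longleftrightarrow> (\<exists>p. A = {n. \<exists>y. computes p [n] y})"

section \<open>Logics and theories\<close>

text \<open>
  The set of formulas is the type \<open>'f\<close>, \<open>code\<close> is its coding by natural numbers,
  \<open>Sig1\<close> the set of \<open>\<Sigma>\<^sub>1\<close>-formulas. Only the values of \<open>neg\<close> on \<open>Sig1\<close> are ever used.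
\<close>

definition is_logic :: "('f set \<Rightarrow> 'f \<Rightarrow> bool) \<Rightarrow> bool" where
  "is_logic L \<longleftrightarrow>
     (\<forall>\<Gamma> \<phi>. L (\<Gamma> \<union> {\<phi>}) \<phi>) \<and>
     (\<forall>\<Gamma> \<Delta> \<phi>. L \<Gamma> \<phi> \<longrightarrow> (\<forall>\<gamma>\<in>\<Gamma>. L \<Delta> \<gamma>) \<longrightarrow> L \<Delta> \<phi>)"

definition Cn :: "('f set \<Rightarrow> 'f \<Rightarrow> bool) \<Rightarrow> 'f set \<Rightarrow> 'f set" where
  "Cn L T = {\<phi>. L T \<phi>}"

definition decidable_theory ::
    "('f \<Rightarrow> nat) \<Rightarrow> ('f set \<Rightarrow> 'f \<Rightarrow> bool) \<Rightarrow> 'f set \<Rightarrow> bool" where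
  "decidable_theory code L T \<longleftrightarrow> recursive_set (code ` Cn L T)"

definition strengthens :: "('f set \<Rightarrow> 'f \<Rightarrow> bool) \<Rightarrow> 'f set \<Rightarrow> 'f set \<Rightarrow> bool" where
  "strengthens L S T \<longleftrightarrow> T \<subseteq> Cn L S"

definition consistent ::
    "'f set \<Rightarrow> ('f \<Rightarrow> 'f) \<Rightarrow> ('f set \<Rightarrow> 'f \<Rightarrow> bool) \<Rightarrow> 'f set \<Rightarrow> bool" where
  "consistent Sig1 neg L T \<longleftrightarrow> \<not> (\<exists>\<phi>\<in>Sig1. L T \<phi> \<and> L T (neg \<phi>))"

definition essentially_undecidable ::
    "('f \<Rightarrow> nat) \<Rightarrow> 'f set \<Rightarrow> ('f \<Rightarrow> 'f) \<Rightarrow> ('f set \<Rightarrow> 'f \<Rightarrow> bool) \<Rightarrow> 'f set \<Rightarrow> bool" where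
  "essentially_undecidable code Sig1 neg L T \<longleftrightarrow>
     consistent Sig1 neg L T \<and>
     (\<forall>S. consistent Sig1 neg L S \<and> strengthens L S T \<longrightarrow> \<not> decidable_theory code L S)"

definition rosser ::
    "('f \<Rightarrow> nat) \<Rightarrow> 'f set \<Rightarrow> ('f \<Rightarrow> 'f) \<Rightarrow> ('f set \<Rightarrow> 'f \<Rightarrow> bool) \<Rightarrow> 'f set \<Rightarrow> bool" where
  "rosser code Sig1 neg L T \<longleftrightarrow>
     (\<forall>A B. re_set A \<and> re_set B \<and> A \<inter> B = {} \<longrightarrow>
        (\<exists>\<phi> :: nat \<Rightarrow> 'f.
           (\<forall>n. \<phi> n \<in> Sig1) \<and> recursive_fun (\<lambda>n. code (\<phi> n)) \<and>
           (\<forall>n\<in>A. L T (\<phi> n)) \<and> (\<forall>n\<in>B. L T (neg (\<phi> n)))))"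

end

theory Submission
  imports Defs "HOL-Library.Nat_Bijection"
begin

text \<open>
  A decidable consistent strengthening of a Rosser theory would recursively separate every pair of
  disjoint recursively enumerable sets. To see that some pair is recursively inseparable, we run
  programs on an abstract machine whose configurations are numbers and whose step function is
  recursive, and diagonalise: \<open>A\<close> and \<open>B\<close> are the sets of those \<open>e\<close> for which the machine
  started with program \<open>e\<close> on input \<open>e\<close> halts with value 0, respectively 1. A separating total
  recursive function would disagree with itself at its own code. Only one direction of the
  simulation is needed, namely that the machine reaches every value that a program computes.
\<close>

section \<open>Total recursive functions of a fixed arity\<close>

text \<open>Packing all arguments into one list makes any compound expression in the entries
  \<open>xs ! i\<close> a single function, so its recursiveness follows by applying closure rules
  backwards.\<close>

definition total_rec :: "nat \<Rightarrow> (nat list \<Rightarrow> nat) \<Rightarrow> bool" where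
  "total_rec k f \<longleftrightarrow> (\<exists>p. \<forall>xs. length xs = k \<longrightarrow> computes p xs (f xs))"

definition recursive_fun2 :: "(nat \<Rightarrow> nat \<Rightarrow> nat) \<Rightarrow> bool" where
  "recursive_fun2 f \<longleftrightarrow> (\<exists>p. \<forall>a b. computes p [a, b] (f a b))"

lemma total_rec_nth: "i < k \<Longrightarrow> total_rec k (\<lambda>xs. xs ! i)"
  unfolding total_rec_def by (metis computes.proj)

lemma computes_comp1:
  "computes g xs y \<Longrightarrow> computes f [y] z \<Longrightarrow> computes (Comp f [g]) xs z"
  by (rule computes.comp[of _ _ "[y]"]) auto

lemma computes_comp2:
  "computes g xs y \<Longrightarrow> computes h xs y' \<Longrightarrow> computes f [y, y'] z
    \<Longrightarrow> computes (Comp f [g, h]) xs z"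
  by (rule computes.comp[of _ _ "[y, y']"]) auto

lemma total_rec_comp1:
  "recursive_fun f \<Longrightarrow> total_rec k g \<Longrightarrow> total_rec k (\<lambda>xs. f (g xs))"
  unfolding total_rec_def recursive_fun_def by (meson computes_comp1)

lemma total_rec_comp2:
  "recursive_fun2 f \<Longrightarrow> total_rec k g \<Longrightarrow> total_rec k h \<Longrightarrow> total_rec k (\<lambda>xs. f (g xs) (h xs))"
  unfolding total_rec_def recursive_fun2_def by (meson computes_comp2)

lemma recursive_funI: "total_rec 1 (\<lambda>xs. f (xs ! 0)) \<Longrightarrow> recursive_fun f"
proof -
  assume "total_rec 1 (\<lambda>xs. f (xs ! 0))"
  then obtain p where p: "\<And>xs. length xs = 1 \<Longrightarrow> computes p xs (f (xs ! 0))"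
    unfolding total_rec_def by blast
  have "computes p [n] (f n)" for n using p[of "[n]"] by simp
  then show ?thesis unfolding recursive_fun_def by blast
qed

lemma recursive_fun2I: "total_rec 2 (\<lambda>xs. f (xs ! 0) (xs ! 1)) \<Longrightarrow> recursive_fun2 f"
proof -
  assume "total_rec 2 (\<lambda>xs. f (xs ! 0) (xs ! 1))"
  then obtain p where p: "\<And>xs. length xs = 2 \<Longrightarrow> computes p xs (f (xs ! 0) (xs ! 1))"
    unfolding total_rec_def by blast
  have "computes p [a, b] (f a b)" for a b using p[of "[a, b]"] by simp
  then show ?thesis unfolding recursive_fun2_def by blast
qed

lemma recursive_fun_Suc: "recursive_fun Suc"
  unfolding recursive_fun_def by (metis computes.succ)

lemmas total_rec_Suc = total_rec_comp1[OF recursive_fun_Suc]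

lemma total_rec_const: "total_rec k (\<lambda>xs. c)"
proof (induction c)
  case 0
  show ?case unfolding total_rec_def by (metis computes.zero)
next
  case (Suc c)
  then show ?case by (rule total_rec_Suc)
qed

section \<open>Iteration, truncated subtraction and case distinction\<close>

lemma recursive_fun2_funpow:
  assumes "recursive_fun s"
  shows "recursive_fun2 (\<lambda>t c. (s ^^ t) c)"
proof -
  obtain p where p: "\<And>n. computes p [n] (s n)"
    using assms unfolding recursive_fun_def by blast
  \<comment> \<open>The step program of \<open>PrimRec\<close> sees counter, previous value and
    parameter in this order, so \<open>Proj 1\<close> fetches the value to which \<open>s\<close> is
    applied once more.\<close>
  have "computes (PrimRec (Proj 0) (Comp p [Proj 1])) [t, c] ((s ^^ t) c)" for t c
  proof (induction t)
    case 0
    show ?case using computes.primrec_0 computes.proj[of 0 "[c]"] by simp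
  next
    case (Suc t)
    have "computes (Comp p [Proj 1]) [t, (s ^^ t) c, c] (s ((s ^^ t) c))"
      using computes.proj[of 1 "[t, (s ^^ t) c, c]"] p by (auto intro: computes_comp1)
    with Suc show ?case by (auto intro: computes.primrec_Suc)
  qed
  then show ?thesis unfolding recursive_fun2_def by blast
qed

lemma recursive_fun_pred: "recursive_fun (\<lambda>n. n - 1)"
proof -
  have "computes (PrimRec Zero (Proj 0)) [n] (n - 1)" for n
  proof (induction n)
    case 0
    show ?case using computes.primrec_0[OF computes.zero] by simp
  next
    case (Suc n)
    then show ?case
      using computes.primrec_Suc[OF Suc, of "n"] computes.proj[of 0 "[n, n - 1]"] by simp
  qed
  then show ?thesis unfolding recursive_fun_def by blast
qed

lemma recursive_fun2_add: "recursive_fun2 (+)"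
proof -
  have "(\<lambda>t c. (Suc ^^ t) c) = (+)" by (intro ext) simp
  with recursive_fun2_funpow[OF recursive_fun_Suc] show ?thesis by simp
qed

lemmas total_rec_add = total_rec_comp2[OF recursive_fun2_add]

lemma total_rec_diff:
  assumes "total_rec k f" "total_rec k g"
  shows "total_rec k (\<lambda>xs. f xs - g xs)"
proof -
  \<comment> \<open>The subtrahend is the number of iterations of the predecessor, hence the swapped
    order of the assumptions below.\<close>
  have "((\<lambda>n. n - 1) ^^ t) c = c - t" for t c :: nat by (induction t) auto
  with total_rec_comp2[OF recursive_fun2_funpow[OF recursive_fun_pred] assms(2) assms(1)]
  show ?thesis by simp
qed

lemma total_rec_if_zero:
  assumes "total_rec k f" "total_rec k g" "total_rec k h"
  shows "total_rec k (\<lambda>xs. if f xs = 0 then g xs else h xs)"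
proof -
  \<comment> \<open>At a successor the step program sees \<open>[a, previous, b, c]\<close>, so
    \<open>Proj 3\<close> discards the recursion and returns \<open>c\<close>. Both branches get
    evaluated, which is harmless since both are total.\<close>
  have cond: "computes (PrimRec (Proj 0) (Proj 3)) [a, b, c] (if a = 0 then b else c)" for a b c
  proof (induction a)
    case 0
    show ?case using computes.primrec_0 computes.proj[of 0 "[b, c]"] by simp
  next
    case (Suc a)
    show ?case
      using computes.primrec_Suc[OF Suc] computes.proj[of 3 "[a, if a = 0 then b else c, b, c]"]
      by simp
  qed
  obtain p q r where pqr: "\<And>xs. length xs = k \<Longrightarrow> computes p xs (f xs)"
    "\<And>xs. length xs = k \<Longrightarrow> computes q xs (g xs)"
    "\<And>xs. length xs = k \<Longrightarrow> computes r xs (h xs)"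
    using assms unfolding total_rec_def by metis
  have "computes (Comp (PrimRec (Proj 0) (Proj 3)) [p, q, r]) xs
      (if f xs = 0 then g xs else h xs)" if "length xs = k" for xs
    by (rule computes.comp[OF _ cond]) (use pqr that in auto)
  then show ?thesis unfolding total_rec_def by blast
qed

lemma total_rec_if_eq:
  assumes "total_rec k f" "total_rec k f'" "total_rec k g" "total_rec k h"
  shows "total_rec k (\<lambda>xs. if f xs = f' xs then g xs else h xs)"
proof -
  have "total_rec k (\<lambda>xs. if (f xs - f' xs) + (f' xs - f xs) = 0 then g xs else h xs)"
    by (intro total_rec_if_zero total_rec_add total_rec_diff assms)
  moreover have "(f xs - f' xs) + (f' xs - f xs) = 0 \<longleftrightarrow> f xs = f' xs" for xs by auto
  ultimately show ?thesis by simp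
qed

section \<open>Unbounded search\<close>

lemma computes_Mu_Least:
  assumes "\<And>w. computes p (w # xs) (f w)" "\<exists>w. f w = 0"
  shows "computes (Mu p) xs (LEAST w. f w = 0)"
proof (rule computes.mu)
  show "computes p ((LEAST w. f w = 0) # xs) 0"
    using assms(1)[of "LEAST w. f w = 0"] LeastI_ex[OF assms(2)] by simp
  show "\<forall>i<LEAST w. f w = 0. \<exists>y. computes p (i # xs) (Suc y)"
    by (metis assms(1) not_less_Least not0_implies_Suc)
qed

lemma recursive_fun_Least:
  assumes "recursive_fun2 f" "\<And>n. \<exists>w. f w n = 0"
  shows "recursive_fun (\<lambda>n. LEAST w. f w n = 0)"
proof -
  obtain p where p: "\<And>w n. computes p [w, n] (f w n)"
    using assms(1) unfolding recursive_fun2_def by blast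
  show ?thesis
    unfolding recursive_fun_def using computes_Mu_Least[OF p assms(2)] by blast
qed

text \<open>The set is the domain of the search for a zero. If the search stops, the value 0 found
  there is that of \<open>f\<close>, by determinism.\<close>

lemma re_set_ex_zero:
  assumes "recursive_fun2 f"
  shows "re_set {n. \<exists>t. f t n = 0}"
proof -
  obtain p where p: "\<And>w n. computes p [w, n] (f w n)"
    using assms(1) unfolding recursive_fun2_def by blast
  have "(\<exists>t. f t n = 0) \<longleftrightarrow> (\<exists>y. computes (Mu p) [n] y)" for n
    using computes_Mu_Least[OF p] by (metis computes_MuE computes_deterministic p)
  then show ?thesis unfolding re_set_def by blast
qed

section \<open>Pairing\<close>

definition pair :: "nat \<Rightarrow> nat \<Rightarrow> nat" where
  "pair a b = prod_encode (a, b)"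

definition pfst :: "nat \<Rightarrow> nat" where
  "pfst z = fst (prod_decode z)"

definition psnd :: "nat \<Rightarrow> nat" where
  "psnd z = snd (prod_decode z)"

lemma pfst_pair [simp]: "pfst (pair a b) = a"
  and psnd_pair [simp]: "psnd (pair a b) = b"
  by (simp_all add: pair_def pfst_def psnd_def)

lemma pair_0_0: "pair 0 0 = 0"
  by (simp add: pair_def prod_encode_def)

lemma pair_eq_iff [simp]: "pair a b = pair c d \<longleftrightarrow> a = c \<and> b = d"
  by (simp add: pair_def)

lemma recursive_fun_triangle: "recursive_fun triangle"
proof -
  have "recursive_fun2 (\<lambda>a b. b + Suc a)"
    by (intro recursive_fun2I total_rec_add total_rec_Suc total_rec_nth) auto
  then obtain p where p: "\<And>a b. computes p [a, b] (b + Suc a)"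
    unfolding recursive_fun2_def by blast
  have "computes (PrimRec Zero p) [n] (triangle n)" for n
  proof (induction n)
    case 0
    show ?case using computes.primrec_0[OF computes.zero] by simp
  next
    case (Suc n)
    show ?case using computes.primrec_Suc[OF Suc p] by simp
  qed
  then show ?thesis unfolding recursive_fun_def by blast
qed

lemmas total_rec_triangle = total_rec_comp1[OF recursive_fun_triangle]

lemma total_rec_pair:
  "total_rec k f \<Longrightarrow> total_rec k g \<Longrightarrow> total_rec k (\<lambda>xs. pair (f xs) (g xs))"
  unfolding pair_def prod_encode_def prod.case
  by (intro total_rec_triangle total_rec_add)

text \<open>Since \<open>pair a b\<close> is \<open>triangle (a + b) + a\<close>, the index a + b of
  the antidiagonal determines both components. The equation expresses z <
  \<open>triangle (Suc w)\<close> in the form required for minimisation.\<close>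

definition pdiag :: "nat \<Rightarrow> nat" where
  "pdiag z = (LEAST w. Suc z - triangle (Suc w) = 0)"

lemma triangle_mono: "a \<le> b \<Longrightarrow> triangle a \<le> triangle b"
  by (induction b) (auto simp: le_Suc_eq)

lemma pdiag_pair: "pdiag (pair a b) = a + b"
  unfolding pdiag_def
proof (rule Least_equality)
  show "Suc (pair a b) - triangle (Suc (a + b)) = 0"
    by (simp add: pair_def prod_encode_def)
next
  fix w assume w: "Suc (pair a b) - triangle (Suc w) = 0"
  show "a + b \<le> w"
  proof (rule ccontr)
    assume "\<not> a + b \<le> w"
    then have "triangle (Suc w) \<le> triangle (a + b)" by (intro triangle_mono) simp
    with w show False by (simp add: pair_def prod_encode_def)
  qed
qed

lemma pair_surj: obtains a b where "z = pair a b"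
  by (metis pair_def prod.collapse prod_decode_inverse)

lemma recursive_fun_pdiag: "recursive_fun pdiag"
  unfolding pdiag_def[abs_def]
proof (rule recursive_fun_Least)
  show "recursive_fun2 (\<lambda>w z. Suc z - triangle (Suc w))"
    by (intro recursive_fun2I total_rec_diff total_rec_triangle total_rec_Suc total_rec_nth) auto
  show "\<exists>w. Suc z - triangle (Suc w) = 0" for z
    by (rule exI[of _ z]) simp
qed

lemmas total_rec_pdiag = total_rec_comp1[OF recursive_fun_pdiag]

lemma pfst_eq: "pfst z = z - triangle (pdiag z)"
  by (rule pair_surj[of z]) (simp add: pdiag_pair, simp add: pair_def prod_encode_def)

lemma psnd_eq: "psnd z = pdiag z - pfst z"
  by (rule pair_surj[of z]) (simp add: pdiag_pair)

lemma total_rec_pfst: "total_rec k f \<Longrightarrow> total_rec k (\<lambda>xs. pfst (f xs))"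
  unfolding pfst_eq by (intro total_rec_diff total_rec_triangle total_rec_pdiag)

lemma total_rec_psnd: "total_rec k f \<Longrightarrow> total_rec k (\<lambda>xs. psnd (f xs))"
  unfolding psnd_eq by (intro total_rec_diff total_rec_pdiag total_rec_pfst)

lemmas total_rec_intros =
  total_rec_const total_rec_Suc total_rec_diff total_rec_if_eq
  total_rec_pair total_rec_pfst total_rec_psnd

section \<open>A machine with a recursive step function\<close>

text \<open>
  Lists are coded by iterated pairing with \<open>[]\<close> as 0. Hence lists differing by trailing zeros share
  a code; this is harmless for argument lists, which are never tested for their end, and cannot
  happen for lists of programs, whose codes are nonzero.
\<close>

primrec list_code :: "nat list \<Rightarrow> nat" where
  "list_code [] = 0"
| "list_code (x # xs) = pair x (list_code xs)"

text \<open>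
  A configuration \<open>pair (pair i K) (pair x D)\<close> has the current instruction \<open>i\<close>, the remaining
  instructions \<open>K\<close>, and a data stack with top \<open>x\<close>. An instruction \<open>pair t a\<close> has tag \<open>t\<close>; tags 1 to 6
  are the constructors of programs in order, and such an instruction replaces the arguments on
  top of the stack by the value of the program. The auxiliary instructions are:
  7 evaluates a list of programs, 8 swaps the two topmost entries, 9 conses, 10 forms the argument
  of the step function of a primitive recursion, 11 tries a candidate for a minimum, 12 inspects
  the outcome of such a trial. Tag 0 halts.
\<close>

definition exec :: "nat \<Rightarrow> nat \<Rightarrow> nat \<Rightarrow> nat \<Rightarrow> nat \<Rightarrow> nat" where
  "exec t a K x D =
    (if t = 1 then pair K (pair 0 D)
     else if t = 2 then pair K (pair (Suc (pfst x)) D)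
     else if t = 3 then
       (if a = 0 then pair K (pair (pfst x) D)
        else pair (pair (pair 3 (a - 1)) K) (pair (psnd x) D))
     else if t = 4 then pair (pair (pair 7 (psnd a)) (pair (pfst a) K)) (pair x D)
     else if t = 5 then
       (if pfst x = 0 then pair (pair (pfst a) K) (pair (psnd x) D)
        else pair (pair (pair 5 a) (pair (pair 10 0) (pair (psnd a) K)))
               (pair (pair (pfst x - 1) (psnd x)) (pair (pair (pfst x - 1) (psnd x)) D)))
     else if t = 6 then pair (pair (pair 11 a) K) (pair (pair 0 x) D)
     else if t = 7 then
       (if a = 0 then pair K (pair 0 D)
        else pair (pair (pfst a) (pair (pair 8 0) (pair (pair 7 (psnd a)) (pair (pair 9 0) K))))
               (pair x (pair x D)))
     else if t = 8 then pair K (pair (pfst D) (pair x (psnd D)))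
     else if t = 9 then pair K (pair (pair (pfst D) x) (psnd D))
     else if t = 10 then pair K (pair (pair (pfst (pfst D)) (pair x (psnd (pfst D)))) (psnd D))
     else if t = 11 then pair (pair a (pair (pair 12 a) K)) (pair x (pair x D))
     else if t = 12 then
       (if x = 0 then pair K (pair (pfst (pfst D)) (psnd D))
        else pair (pair (pair 11 a) K)
               (pair (pair (Suc (pfst (pfst D))) (psnd (pfst D))) (psnd D)))
     else pair (pair (pair t a) K) (pair x D))"

definition step :: "nat \<Rightarrow> nat" where
  "step c = exec (pfst (pfst (pfst c))) (psnd (pfst (pfst c))) (psnd (pfst c))
     (pfst (psnd c)) (psnd (psnd c))"

lemma step_eq: "step (pair (pair (pair t a) K) (pair x D)) = exec t a K x D"
  by (simp add: step_def)

lemma recursive_fun_step: "recursive_fun step"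
  unfolding step_def[abs_def] exec_def
  by (intro recursive_funI total_rec_intros total_rec_nth) auto

definition reaches :: "nat \<Rightarrow> nat \<Rightarrow> bool" where
  "reaches c d \<longleftrightarrow> (\<exists>t. (step ^^ t) c = d)"

lemma reaches_trans [trans]: "reaches c d \<Longrightarrow> reaches d e \<Longrightarrow> reaches c e"
  unfolding reaches_def by (metis funpow_add comp_apply)

lemma reaches_step: "step c = d \<Longrightarrow> reaches c d"
  unfolding reaches_def by (rule exI[of _ 1]) simp

lemma reaches_exec:
  "exec t a K x D = d \<Longrightarrow> reaches (pair (pair (pair t a) K) (pair x D)) d"
  by (rule reaches_step) (simp add: step_eq)

section \<open>Programs as instructions, and correctness of their execution\<close>

fun code_recf :: "recf \<Rightarrow> nat" where
  "code_recf Zero = pair 1 0"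
| "code_recf Succ = pair 2 0"
| "code_recf (Proj i) = pair 3 i"
| "code_recf (Comp f gs) = pair 4 (pair (code_recf f) (list_code (map code_recf gs)))"
| "code_recf (PrimRec g h) = pair 5 (pair (code_recf g) (code_recf h))"
| "code_recf (Mu f) = pair 6 (code_recf f)"

lemma pair_neq_0: "a \<noteq> 0 \<Longrightarrow> pair a b \<noteq> 0"
  by (metis pair_0_0 pair_eq_iff)

lemma code_recf_neq_0: "code_recf p \<noteq> 0"
  by (cases p) (simp_all add: pair_neq_0)

text \<open>Quantifying over \<open>K\<close> and \<open>D\<close> lets an evaluation run inside any
  surrounding computation and leave it intact; this is what makes simulations compose.\<close>

definition evaluates :: "nat \<Rightarrow> nat \<Rightarrow> nat \<Rightarrow> bool" where
  "evaluates i x y \<longleftrightarrow> (\<forall>K D. reaches (pair (pair i K) (pair x D)) (pair K (pair y D)))"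

lemma evaluatesD: "evaluates i x y \<Longrightarrow> reaches (pair (pair i K) (pair x D)) (pair K (pair y D))"
  by (simp add: evaluates_def)

lemma evaluates_proj:
  "i < length xs \<Longrightarrow> evaluates (pair 3 i) (list_code xs) (xs ! i)"
proof (induction i arbitrary: xs)
  case 0
  then show ?case
    by (cases xs) (auto simp: evaluates_def exec_def intro!: reaches_exec)
next
  case (Suc i)
  then obtain x ys where xs: "xs = x # ys" "i < length ys" by (cases xs) auto
  show ?case unfolding evaluates_def
  proof (intro allI)
    fix K D
    have "reaches (pair (pair (pair 3 (Suc i)) K) (pair (list_code xs) D))
        (pair (pair (pair 3 i) K) (pair (list_code ys) D))"
      by (rule reaches_exec) (simp add: exec_def xs)
    also have "reaches \<dots> (pair K (pair (ys ! i) D))"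
      by (rule evaluatesD[OF Suc.IH[OF xs(2)]])
    finally show "reaches (pair (pair (pair 3 (Suc i)) K) (pair (list_code xs) D))
        (pair K (pair (xs ! Suc i) D))" by (simp add: xs)
  qed
qed

lemma evaluates_list:
  "list_all2 (\<lambda>g y. evaluates (code_recf g) x y) gs ys
    \<Longrightarrow> evaluates (pair 7 (list_code (map code_recf gs))) x (list_code ys)"
proof (induction rule: list_all2_induct)
  case Nil
  show ?case by (auto simp: evaluates_def exec_def intro!: reaches_exec)
next
  case (Cons g gs y ys)
  let ?l = "list_code (map code_recf gs)"
  show ?case unfolding evaluates_def
  proof (intro allI)
    fix K D
    let ?K = "pair (pair 7 ?l) (pair (pair 9 0) K)"
    \<comment> \<open>As program codes are nonzero, the code of a nonempty program list is nonzero,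
      and the test \<open>a = 0\<close> takes the right branch. The duplicated argument serves the
      remaining programs.\<close>
    have "reaches (pair (pair (pair 7 (list_code (map code_recf (g # gs)))) K) (pair x D))
        (pair (pair (code_recf g) (pair (pair 8 0) ?K)) (pair x (pair x D)))"
      by (rule reaches_exec) (simp add: exec_def pair_neq_0 code_recf_neq_0)
    also have "reaches \<dots> (pair (pair (pair 8 0) ?K) (pair y (pair x D)))"
      by (rule evaluatesD[OF Cons.hyps(1)])
    also have "reaches \<dots> (pair ?K (pair x (pair y D)))"
      by (rule reaches_exec) (simp add: exec_def)
    also have "reaches \<dots> (pair (pair (pair 9 0) K) (pair (list_code ys) (pair y D)))"
      by (rule evaluatesD[OF Cons.IH])
    also have "reaches \<dots> (pair K (pair (list_code (y # ys)) D))"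
      by (rule reaches_exec) (simp add: exec_def)
    finally show "reaches (pair (pair (pair 7 (list_code (map code_recf (g # gs)))) K) (pair x D))
        (pair K (pair (list_code (y # ys)) D))" .
  qed
qed

text \<open>Only the start at 0 is wanted; allowing any candidate \<open>i\<close> up to
  \<open>n\<close> permits induction downwards from the successful trial at
  \<open>n\<close>.\<close>

lemma reaches_search:
  assumes "evaluates f (pair n xs) 0" "\<forall>i<n. \<exists>y. evaluates f (pair i xs) (Suc y)" "i \<le> n"
  shows "reaches (pair (pair (pair 11 f) K) (pair (pair i xs) D)) (pair K (pair n D))"
  using assms(3)
proof (induction rule: inc_induct)
  case base
  have "reaches (pair (pair (pair 11 f) K) (pair (pair n xs) D))
      (pair (pair f (pair (pair 12 f) K)) (pair (pair n xs) (pair (pair n xs) D)))"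
    by (rule reaches_exec) (simp add: exec_def)
  also have "reaches \<dots> (pair (pair (pair 12 f) K) (pair 0 (pair (pair n xs) D)))"
    by (rule evaluatesD[OF assms(1)])
  also have "reaches \<dots> (pair K (pair n D))"
    by (rule reaches_exec) (simp add: exec_def)
  finally show ?case .
next
  case (step i)
  obtain y where y: "evaluates f (pair i xs) (Suc y)" using assms(2) step.hyps by blast
  have "reaches (pair (pair (pair 11 f) K) (pair (pair i xs) D))
      (pair (pair f (pair (pair 12 f) K)) (pair (pair i xs) (pair (pair i xs) D)))"
    by (rule reaches_exec) (simp add: exec_def)
  also have "reaches \<dots> (pair (pair (pair 12 f) K) (pair (Suc y) (pair (pair i xs) D)))"
    by (rule evaluatesD[OF y])
  also have "reaches \<dots> (pair (pair (pair 11 f) K) (pair (pair (Suc i) xs) D))"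
    by (rule reaches_exec) (simp add: exec_def)
  also note step.IH
  finally show ?case .
qed

text \<open>The induction follows the derivation rather than the program, so that the earlier stages
  of a recursion and the failed trials of a search have induction hypotheses.\<close>

lemma evaluates_code_recf:
  "computes p xs y \<Longrightarrow> evaluates (code_recf p) (list_code xs) y"
proof (induction rule: computes.induct)
  case (zero xs)
  show ?case by (auto simp: evaluates_def exec_def intro!: reaches_exec)
next
  case (succ x)
  show ?case by (auto simp: evaluates_def exec_def intro!: reaches_exec)
next
  case (proj i xs)
  then show ?case by (simp add: evaluates_proj)
next
  case (comp xs gs ys f z)
  let ?l = "list_code (map code_recf gs)"
  have l: "evaluates (pair 7 ?l) (list_code xs) (list_code ys)"
    by (rule evaluates_list) (use comp.IH(1) in \<open>auto elim!: list_all2_mono\<close>)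
  show ?case unfolding evaluates_def
  proof (intro allI)
    fix K D
    have "reaches (pair (pair (code_recf (Comp f gs)) K) (pair (list_code xs) D))
        (pair (pair (pair 7 ?l) (pair (code_recf f) K)) (pair (list_code xs) D))"
      unfolding code_recf.simps by (rule reaches_exec) (simp add: exec_def)
    also have "reaches \<dots> (pair (pair (code_recf f) K) (pair (list_code ys) D))"
      by (rule evaluatesD[OF l])
    also have "reaches \<dots> (pair K (pair z D))"
      by (rule evaluatesD[OF comp.IH(2)])
    finally show "reaches (pair (pair (code_recf (Comp f gs)) K) (pair (list_code xs) D))
        (pair K (pair z D))" .
  qed
next
  case (primrec_0 g xs y h)
  show ?case unfolding evaluates_def
  proof (intro allI)
    fix K D
    have "reaches (pair (pair (code_recf (PrimRec g h)) K) (pair (list_code (0 # xs)) D))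
        (pair (pair (code_recf g) K) (pair (list_code xs) D))"
      unfolding code_recf.simps by (rule reaches_exec) (simp add: exec_def)
    also have "reaches \<dots> (pair K (pair y D))"
      by (rule evaluatesD[OF primrec_0.IH])
    finally show "reaches (pair (pair (code_recf (PrimRec g h)) K) (pair (list_code (0 # xs)) D))
        (pair K (pair y D))" .
  qed
next
  case (primrec_Suc g h n xs y z)
  show ?case unfolding evaluates_def
  proof (intro allI)
    fix K D
    let ?x = "list_code (n # xs)" and ?K = "pair (code_recf h) K"
    have "reaches (pair (pair (code_recf (PrimRec g h)) K) (pair (list_code (Suc n # xs)) D))
        (pair (pair (code_recf (PrimRec g h)) (pair (pair 10 0) ?K)) (pair ?x (pair ?x D)))"
      unfolding code_recf.simps by (rule reaches_exec) (simp add: exec_def)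
    also have "reaches \<dots> (pair (pair (pair 10 0) ?K) (pair y (pair ?x D)))"
      by (rule evaluatesD[OF primrec_Suc.IH(1)])
    also have "reaches \<dots> (pair ?K (pair (list_code (n # y # xs)) D))"
      by (rule reaches_exec) (simp add: exec_def)
    also have "reaches \<dots> (pair K (pair z D))"
      by (rule evaluatesD[OF primrec_Suc.IH(2)])
    finally show "reaches
        (pair (pair (code_recf (PrimRec g h)) K) (pair (list_code (Suc n # xs)) D))
        (pair K (pair z D))" .
  qed
next
  case (mu f n xs)
  show ?case unfolding evaluates_def
  proof (intro allI)
    fix K D
    have "reaches (pair (pair (code_recf (Mu f)) K) (pair (list_code xs) D))
        (pair (pair (pair 11 (code_recf f)) K) (pair (pair 0 (list_code xs)) D))"
      unfolding code_recf.simps by (rule reaches_exec) (simp add: exec_def)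
    also have "reaches \<dots> (pair K (pair n D))"
      by (rule reaches_search) (use mu.IH in auto)
    finally show "reaches (pair (pair (code_recf (Mu f)) K) (pair (list_code xs) D))
        (pair K (pair n D))" .
  qed
qed

section \<open>Recursively inseparable sets\<close>

text \<open>The first \<open>pair e 0\<close> is the instruction \<open>e\<close> with nothing left
  to do after it; the second is the argument list \<open>[e]\<close>, on an otherwise empty
  stack.\<close>

definition diagonal_init :: "nat \<Rightarrow> nat" where
  "diagonal_init e = pair (pair e 0) (pair (pair e 0) 0)"

text \<open>Because \<open>pair 0 0\<close> is 0, an empty list of remaining instructions itself
  reads as an instruction with tag 0, and the configuration is a fixed point of
  \<open>step\<close>.\<close>

definition halted :: "nat \<Rightarrow> nat" where
  "halted y = pair 0 (pair y 0)"

definition diagonal_set :: "nat \<Rightarrow> nat set" where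
  "diagonal_set y = {e. reaches (diagonal_init e) (halted y)}"

lemma step_halted: "step (halted y) = halted y"
  using step_eq[of 0 0 0 y 0] by (simp add: exec_def halted_def pair_0_0)

lemma reaches_halted_unique:
  assumes "reaches c (halted y)" "reaches c (halted z)"
  shows "y = z"
proof -
  have stay: "(step ^^ t) (halted y) = halted y" for t y
    by (induction t) (simp_all add: step_halted)
  obtain s t where st: "(step ^^ s) c = halted y" "(step ^^ t) c = halted z"
    using assms unfolding reaches_def by blast
  have "(step ^^ (t + s)) c = halted y" using st(1) by (simp add: funpow_add stay)
  moreover have "(step ^^ (s + t)) c = halted z" using st(2) by (simp add: funpow_add stay)
  ultimately show ?thesis by (simp add: add.commute halted_def)
qed

lemma re_set_diagonal_set: "re_set (diagonal_set y)"
proof -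
  let ?f = "\<lambda>t e. if (step ^^ t) (diagonal_init e) = halted y then 0 else (1 :: nat)"
  have "recursive_fun2 ?f"
    unfolding diagonal_init_def
    by (intro recursive_fun2I total_rec_intros total_rec_nth
        total_rec_comp2[OF recursive_fun2_funpow[OF recursive_fun_step]]) auto
  then have "re_set {e. \<exists>t. ?f t e = 0}" by (rule re_set_ex_zero)
  moreover have "{e. \<exists>t. ?f t e = 0} = diagonal_set y"
    by (auto simp: diagonal_set_def reaches_def)
  ultimately show ?thesis by simp
qed

lemma diagonal_sets_disjoint: "y \<noteq> z \<Longrightarrow> diagonal_set y \<inter> diagonal_set z = {}"
  by (auto simp: diagonal_set_def dest: reaches_halted_unique)

text \<open>The witness is the code of a program for \<open>f\<close>: run on its own code, it halts
  with the value of \<open>f\<close> there.\<close>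

lemma recursive_fun_diagonal:
  assumes "recursive_fun f"
  obtains e where "e \<in> diagonal_set (f e)"
proof -
  obtain p where p: "\<And>n. computes p [n] (f n)"
    using assms unfolding recursive_fun_def by blast
  have "code_recf p \<in> diagonal_set (f (code_recf p))"
    using evaluatesD[OF evaluates_code_recf[OF p[of "code_recf p"]], of 0 0]
    by (simp add: diagonal_set_def diagonal_init_def halted_def)
  then show ?thesis by (rule that)
qed

text \<open>Diagonalising against the characteristic function of \<open>C\<close> puts
  \<open>e\<close> into \<open>diagonal_set 1\<close> if it lies in \<open>C\<close>, and into
  \<open>diagonal_set 0\<close> otherwise; either contradicts separation.\<close>

lemma diagonal_sets_inseparable:
  assumes "diagonal_set 0 \<subseteq> C" "C \<inter> diagonal_set 1 = {}"
  shows "\<not> recursive_set C"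
proof
  assume "recursive_set C"
  then obtain e where e: "e \<in> diagonal_set (if e \<in> C then 1 else 0)"
    unfolding recursive_set_def by (rule recursive_fun_diagonal)
  show False
  proof (cases "e \<in> C")
    case True
    with e assms(2) show False by auto
  next
    case False
    with e assms(1) show False by auto
  qed
qed

section \<open>From a decidable strengthening to a separating set\<close>

lemma recursive_set_vimage:
  assumes "recursive_set C" "recursive_fun f"
  shows "recursive_set (f -` C)"
proof -
  have f: "total_rec 1 (\<lambda>xs. f (xs ! 0))"
    by (rule total_rec_comp1[OF assms(2) total_rec_nth]) simp
  have "recursive_fun (\<lambda>n. if f n \<in> C then 1 else 0)"
    by (rule recursive_funI, rule total_rec_comp1[OF assms(1)[unfolded recursive_set_def] f])
  then show ?thesis by (simp add: recursive_set_def)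
qed

text \<open>This is the cut rule, with the members of \<open>T\<close> as cut formulas.\<close>

lemma strengthens_provable:
  assumes "is_logic L" "strengthens L S T" "L T \<phi>"
  shows "L S \<phi>"
  using assms unfolding is_logic_def strengthens_def Cn_def by blast

theorem mainTheorem6:
  fixes code :: "'f \<Rightarrow> nat"
    and Sig1 :: "'f set"
    and neg :: "'f \<Rightarrow> 'f"
    and L :: "'f set \<Rightarrow> 'f \<Rightarrow> bool"
    and T :: "'f set"
  assumes "inj code"
    and "is_logic L"
    and "consistent Sig1 neg L T"
    and "rosser code Sig1 neg L T"
  shows "essentially_undecidable code Sig1 neg L T"
  unfolding essentially_undecidable_def
proof (intro conjI allI impI notI)
  show "consistent Sig1 neg L T" by fact
next
  fix S
  assume S: "consistent Sig1 neg L S \<and> strengthens L S T"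
    and dec: "decidable_theory code L S"
  have "re_set (diagonal_set 0) \<and> re_set (diagonal_set 1) \<and> diagonal_set 0 \<inter> diagonal_set 1 = {}"
    by (simp add: re_set_diagonal_set diagonal_sets_disjoint)
  with assms(4) obtain \<phi> where \<phi>: "\<And>n. \<phi> n \<in> Sig1" "recursive_fun (\<lambda>n. code (\<phi> n))"
    "\<And>n. n \<in> diagonal_set 0 \<Longrightarrow> L T (\<phi> n)" "\<And>n. n \<in> diagonal_set 1 \<Longrightarrow> L T (neg (\<phi> n))"
    unfolding rosser_def by meson
  \<comment> \<open>The candidate separator: the indices whose Rosser formula \<open>S\<close>
    proves. As \<open>code\<close> is injective, membership of a code in the image means provability
    of that very formula.\<close>
  define C where "C = (\<lambda>n. code (\<phi> n)) -` (code ` Cn L S)"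
  have C_iff: "n \<in> C \<longleftrightarrow> L S (\<phi> n)" for n
    using assms(1) by (auto simp: C_def Cn_def inj_image_mem_iff)
  have "recursive_set C"
    using dec \<phi>(2) unfolding C_def decidable_theory_def by (rule recursive_set_vimage)
  moreover have "diagonal_set 0 \<subseteq> C"
    using strengthens_provable[OF assms(2)] S \<phi>(3) by (auto simp: C_iff)
  \<comment> \<open>For a common element, \<open>S\<close> would prove a \<Sigma>1-formula and its
    negation.\<close>
  moreover have "C \<inter> diagonal_set 1 = {}"
    using strengthens_provable[OF assms(2)] S \<phi>(1,4) by (fastforce simp: C_iff consistent_def)
  ultimately show False using diagonal_sets_inseparable by blast
qed

end
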